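(* Let $G$ be a group and let $S'$, $T'$, $U'$ be nonempty subsets of $G$ that fulfill the Triple Product Property. Then there exist nonempty subsets $S$, $T$, $U$ of $G$ with $|S|=|S'|$, $|T|=|T'|$, $|U|=|U'|$ and $S\cap T = T\cap U = S\cap U = \{1\}$ such that $S$, $T$, $U$ also fulfill the Triple Product Property.
   Context: For a group $G$ with identity $1$ and a nonempty subset $X\subseteq G$, the right quotient of $X$ is $Q(X):=\{xy^{-1} : x,y\in X\}$. Nonempty subsets $S$, $T$, $U$ of $G$ fulfill the Triple Product Property (TPP) if for all $s\in Q(S)$, $t\in Q(T)$, $u\in Q(U)$, the equation $stu=1$ holds if and only if $s=t=u=1$. $|X|$ denotes the cardinality of $X$. *)

theory Defs
  imports "HOL-Algebra.Group" "HOL-Library.Equipollence"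
begin

definition right_quotient :: "('a, 'b) monoid_scheme \<Rightarrow> 'a set \<Rightarrow> 'a set" where
  "right_quotient G X = {x \<otimes>\<^bsub>G\<^esub> inv\<^bsub>G\<^esub> y | x y. x \<in> X \<and> y \<in> X}"

definition TPP :: "('a, 'b) monoid_scheme \<Rightarrow> 'a set \<Rightarrow> 'a set \<Rightarrow> 'a set \<Rightarrow> bool" where
  "TPP G S T U \<longleftrightarrow>
     S \<subseteq> carrier G \<and> T \<subseteq> carrier G \<and> U \<subseteq> carrier G \<and>
     S \<noteq> {} \<and> T \<noteq> {} \<and> U \<noteq> {} \<and>
     (\<forall>s \<in> right_quotient G S. \<forall>t \<in> right_quotient G T. \<forall>u \<in> right_quotient G U.
        s \<otimes>\<^bsub>G\<^esub> t \<otimes>\<^bsub>G\<^esub> u = \<one>\<^bsub>G\<^esub> \<longleftrightarrow>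
        s = \<one>\<^bsub>G\<^esub> \<and> t = \<one>\<^bsub>G\<^esub> \<and> u = \<one>\<^bsub>G\<^esub>)"

end

theory Submission
  imports Defs "HOL-Algebra.Coset"
begin

text \<open>
  A right translation leaves the right quotient of a set, and hence the TPP, unchanged, so each
  of the three sets may be translated to contain the identity. Then an element \<open>x\<close> common to two of
  them gives \<open>x\<close> in one quotient set and its inverse in the other, and the TPP forces \<open>x\<close> to be
  the identity.
\<close>

context group
begin

text \<open>The translating element cancels in the middle:
  \<open>(x \<otimes> g) \<otimes> inv (y \<otimes> g)\<close> contains the factor
  \<open>g \<otimes> inv g\<close>. A left translation would instead conjugate each quotient by
  \<open>g\<close>.\<close>

lemma right_quotient_r_coset:
  assumes "X \<subseteq> carrier G" "g \<in> carrier G"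
  shows "right_quotient G (X #> g) = right_quotient G X"
proof -
  have cancel: "(x \<otimes> g) \<otimes> inv (y \<otimes> g) = x \<otimes> inv y" if "x \<in> X" "y \<in> X" for x y
  proof -
    have "x \<in> carrier G" "y \<in> carrier G"
      using that assms(1) by auto
    then show ?thesis
      \<comment> \<open>The first pass expands the inverse and nests products to the right, which
        leaves \<open>g \<otimes> (inv g \<otimes> inv y)\<close>; the second regroups to the left
        so that \<open>g\<close> meets \<open>inv g\<close>.\<close>
      using assms(2) by (simp add: inv_mult_group m_assoc) (simp flip: m_assoc)
  qed
  show ?thesis
  proof
    show "right_quotient G (X #> g) \<subseteq> right_quotient G X"
      using cancel by (fastforce simp: right_quotient_def r_coset_def)
  next
    show "right_quotient G X \<subseteq> right_quotient G (X #> g)"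
    proof
      fix z assume "z \<in> right_quotient G X"
      then obtain x y where "x \<in> X" "y \<in> X" "z = x \<otimes> inv y"
        by (auto simp: right_quotient_def)
      moreover from this have "z = (x \<otimes> g) \<otimes> inv (y \<otimes> g)"
        using cancel by simp
      moreover have "x \<otimes> g \<in> X #> g" "y \<otimes> g \<in> X #> g"
        using calculation by (auto simp: r_coset_def)
      ultimately show "z \<in> right_quotient G (X #> g)"
        unfolding right_quotient_def by blast
    qed
  qed
qed

text \<open>Right multiplication by \<open>g\<close> is injective. Stating this with
  \<open>\<approx>\<close> keeps cardinalities meaningful for infinite sets.\<close>

lemma r_coset_eqpoll:
  assumes "X \<subseteq> carrier G" "g \<in> carrier G"
  shows "X #> g \<approx> X"
proof -
  have "X #> g = (\<lambda>x. x \<otimes> g) ` X"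
    by (auto simp: r_coset_def)
  moreover have "inj_on (\<lambda>x. x \<otimes> g) X"
    using inj_on_subset[OF inj_on_multc] assms by blast
  ultimately show ?thesis
    by simp
qed

lemma one_in_r_coset_inv:
  assumes "x \<in> X" "x \<in> carrier G"
  shows "\<one> \<in> X #> inv x"
  using assms by (auto simp: r_coset_def intro!: bexI[of _ x])

text \<open>Apart from inclusion in the carrier and nonemptiness, \<open>TPP\<close> sees the three
  sets only through their right quotients, so the translating elements may be chosen
  independently.\<close>

lemma TPP_r_coset:
  assumes "TPP G S T U" "a \<in> carrier G" "b \<in> carrier G" "c \<in> carrier G"
  shows "TPP G (S #> a) (T #> b) (U #> c)"
  using assms unfolding TPP_def
  by (simp add: right_quotient_r_coset r_coset_subset_G) (auto simp: r_coset_def)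

lemma one_in_right_quotient:
  assumes "X \<noteq> {}" "X \<subseteq> carrier G"
  shows "\<one> \<in> right_quotient G X"
  using assms by (force simp: right_quotient_def)

text \<open>Take \<open>\<one>\<close> as the second entry of the quotient; taking it as the first
  entry yields the inverses.\<close>

lemma subset_right_quotient:
  assumes "\<one> \<in> X" "X \<subseteq> carrier G"
  shows "X \<subseteq> right_quotient G X"
  using assms by (force simp: right_quotient_def)

lemma inv_in_right_quotient:
  assumes "\<one> \<in> X" "X \<subseteq> carrier G" "x \<in> X"
  shows "inv x \<in> right_quotient G X"
  using assms by (force simp: right_quotient_def)

lemma TPP_inter_eq_one:
  assumes tpp: "TPP G S T U" and one: "\<one> \<in> S" "\<one> \<in> T" "\<one> \<in> U"
  shows "S \<inter> T = {\<one>}" "T \<inter> U = {\<one>}" "S \<inter> U = {\<one>}"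
proof -
  have sub: "S \<subseteq> carrier G" "T \<subseteq> carrier G" "U \<subseteq> carrier G"
    using tpp by (auto simp: TPP_def)
  have triple: "s = \<one> \<and> t = \<one> \<and> u = \<one>"
    if "s \<in> right_quotient G S" "t \<in> right_quotient G T" "u \<in> right_quotient G U"
      "s \<otimes> t \<otimes> u = \<one>" for s t u
    using tpp that unfolding TPP_def by blast
  have ones: "\<one> \<in> right_quotient G S" "\<one> \<in> right_quotient G T" "\<one> \<in> right_quotient G U"
    using one sub by (auto intro!: one_in_right_quotient)
  \<comment> \<open>In each of the three cases \<open>x\<close> and \<open>inv x\<close> fill the
    slots of the two sets that share \<open>x\<close>, and \<open>\<one>\<close> fills the remaining
    slot, so the triple product is \<open>\<one>\<close>.\<close>
  have "x = \<one>" if "x \<in> S" "x \<in> T" for x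
    using triple[of x "inv x" \<one>] that sub one ones
      subsetD[OF sub(1), of x] subset_right_quotient[THEN subsetD, of S x]
      inv_in_right_quotient[of T x] by auto
  then show "S \<inter> T = {\<one>}"
    using one by blast
  have "x = \<one>" if "x \<in> T" "x \<in> U" for x
    using triple[of \<one> x "inv x"] that sub one ones
      subsetD[OF sub(2), of x] subset_right_quotient[THEN subsetD, of T x]
      inv_in_right_quotient[of U x] by auto
  then show "T \<inter> U = {\<one>}"
    using one by blast
  \<comment> \<open>Here the filler \<open>\<one>\<close> stands in the middle, so \<open>x\<close>
    and \<open>inv x\<close> still cancel.\<close>
  have "x = \<one>" if "x \<in> S" "x \<in> U" for x
    using triple[of x \<one> "inv x"] that sub one ones
      subsetD[OF sub(1), of x] subset_right_quotient[THEN subsetD, of S x]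
      inv_in_right_quotient[of U x] by auto
  then show "S \<inter> U = {\<one>}"
    using one by blast
qed

end

theorem theorem1:
  fixes G :: "('a, 'b) monoid_scheme" and S' T' U' :: "'a set"
  assumes "group G"
    and "S' \<subseteq> carrier G" and "T' \<subseteq> carrier G" and "U' \<subseteq> carrier G"
    and "S' \<noteq> {}" and "T' \<noteq> {}" and "U' \<noteq> {}"
    and "TPP G S' T' U'"
  shows "\<exists>S T U. S \<subseteq> carrier G \<and> T \<subseteq> carrier G \<and> U \<subseteq> carrier G
           \<and> S \<noteq> {} \<and> T \<noteq> {} \<and> U \<noteq> {}
           \<and> S \<approx> S' \<and> T \<approx> T' \<and> U \<approx> U'
           \<and> S \<inter> T = {\<one>\<^bsub>G\<^esub>} \<and> T \<inter> U = {\<one>\<^bsub>G\<^esub>} \<and> S \<inter> U = {\<one>\<^bsub>G\<^esub>}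
           \<and> TPP G S T U"
proof -
  interpret group G by fact
  obtain a b c where mem: "a \<in> S'" "b \<in> T'" "c \<in> U'"
    using assms by blast
  then have car: "a \<in> carrier G" "b \<in> carrier G" "c \<in> carrier G"
    using assms by auto
  \<comment> \<open>Translating by the inverse of a chosen member sends that member to the
    identity.\<close>
  define S T U where "S = S' #>\<^bsub>G\<^esub> inv\<^bsub>G\<^esub> a" and "T = T' #>\<^bsub>G\<^esub> inv\<^bsub>G\<^esub> b"
    and "U = U' #>\<^bsub>G\<^esub> inv\<^bsub>G\<^esub> c"
  have one: "\<one>\<^bsub>G\<^esub> \<in> S" "\<one>\<^bsub>G\<^esub> \<in> T" "\<one>\<^bsub>G\<^esub> \<in> U"
    using mem car by (auto simp: S_def T_def U_def one_in_r_coset_inv)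
  have tpp: "TPP G S T U"
    unfolding S_def T_def U_def using assms car by (intro TPP_r_coset) auto
  have "S \<approx> S'" "T \<approx> T'" "U \<approx> U'"
    using assms car by (auto simp: S_def T_def U_def intro!: r_coset_eqpoll)
  moreover have "S \<subseteq> carrier G" "T \<subseteq> carrier G" "U \<subseteq> carrier G"
      "S \<noteq> {}" "T \<noteq> {}" "U \<noteq> {}"
    using tpp by (auto simp: TPP_def)
  ultimately show ?thesis
    using TPP_inter_eq_one[OF tpp one] tpp by blast
qed

end
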